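(* Fix a level $k$ and an approximation $(\lambda^{(k,\ell)},v^{(k,\ell)})\in\mathbb R\times\mathfrak V^{(k)}$ with $\|v^{(k,\ell)}\|=1$ such that, for some constant $C_1$, $$\|\bar\lambda^{(k)}\bar v^{(k)}-\lambda^{(k,\ell)}v^{(k,\ell)}\|_0\le C_1\,\eta(\mathfrak V^{(1)})\,\|\bar v^{(k)}-v^{(k,\ell)}\|.$$ Let $\tilde v^{(k,\ell+1)}\in\mathfrak V^{(k)}$ solve $\langle\tilde v^{(k,\ell+1)},w\rangle=\lambda^{(k,\ell)}[v^{(k,\ell)},w]$ for all $w\in\mathfrak V^{(k)}$, and let $\hat v^{(k,\ell+1)}\in\mathfrak V^{(k)}$ be its multigrid approximation, assumed to satisfy $\|\hat v^{(k,\ell+1)}-\tilde v^{(k,\ell+1)}\|\le\theta\|v^{(k,\ell)}-\tilde v^{(k,\ell+1)}\|$ with $\theta<1$ independent of $k,\ell$. Let $\mathfrak V^{(1,k)}:=\mathfrak V^{(1)}+\operatorname{span}\{\hat v^{(k,\ell+1)}\}$ and let $(\lambda^{(k,\ell+1)},v^{(k,\ell+1)})\in\mathbb R\times\mathfrak V^{(1,k)}$, $\langle v^{(k,\ell+1)},v^{(k,\ell+1)}\rangle=1$, be the eigenpair of the Galerkin eigenvalue problem on $\mathfrak V^{(1,k)}$ approximating the target eigenpair. Assume $\bar D_\lambda\eta(\mathfrak V^{(1)})<1$. Then $$\|\bar v^{(k)}-v^{(k,\ell+1)}\|\le\gamma\,\|\bar v^{(k)}-v^{(k,\ell)}\|,\qquad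 \|\bar\lambda^{(k)}\bar v^{(k)}-\lambda^{(k,\ell+1)}v^{(k,\ell+1)}\|_0\le\bar C_\lambda\,\eta(\mathfrak V^{(1)})\,\|\bar v^{(k)}-v^{(k,\ell+1)}\|,$$ where, with $\eta_1:=\eta(\mathfrak V^{(1)})$, $$\gamma=\frac{1}{1-\bar D_\lambda\eta_1}\Big(\theta+(1+\theta)\frac{C_1}{\sqrt{\lambda_1}}\eta_1\Big),\quad \bar C_\lambda=2|\lambda|\Big(1+\frac1{\lambda_1\delta_\lambda}\Big)+\bar\lambda_i^{(1)}\sqrt{1+\frac1{\lambda_1\delta_\lambda^2}\eta_1^2},$$ $$\bar D_\lambda=\frac1{\sqrt{\lambda_1}}\left(2|\lambda|\Big(1+\frac1{\lambda_1\delta_\lambda}\Big)+\bar\lambda_i^{(1)}\sqrt{1+\frac1{\lambda_1\delta_\lambda^2}\eta_1^2}\right).$$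
   Context: Let $V\subset V_0\subset V^*$ be real Hilbert spaces forming a Gelfand triple ($V^*$ dual of $V$; the pairing $[\cdot,\cdot]$ extends the inner product of $V_0$, norm $\|\cdot\|_0$; $V_0\to V^*$ compact and dense). $\mathcal L:V\to V^*$ is a symmetric positive linear bijection, $\langle u,w\rangle:=[\mathcal Lu,w]$, $\|u\|^2=\langle u,u\rangle$. $\mathfrak V^{(1)}\subset\mathfrak V^{(2)}\subset\cdots\subset\mathfrak V^{(q)}\subseteq V$ are nested finite-dimensional (gamblet) subspaces (in the paper $V$ is finite-dimensional and $\mathfrak V^{(q)}=V$). Eigenvalue problem: $(\lambda,v)\in\mathbb R\times V$, $\langle v,v\rangle=1$, $\langle v,w\rangle=\lambda[v,w]$ $\forall w\in V$; eigenvalues $0<\lambda_1\le\lambda_2\le\cdots$. For any subspace $S$ the Galerkin problem is: $(\bar\lambda,\bar v)\in\mathbb R\times S$, $\langle\bar v,\bar v\rangle=1$, $\langle\bar v,w\rangle=\bar\lambda[\bar v,w]$ $\forall w\in S$; on $\mathfrak V^{(k)}$ its eigenpairs are $(\bar\lambda_j^{(k)},\bar v_j^{(k)})$, increasingly ordered, energy-orthonormal. $\eta(S):=\sup_{f\in V_0,\|f\|_0=1}\inf_{w\in S}\|\mathcal L^{-1}f-w\|$. Standing assumptions: a target exact eigenpair $(\lambda,v)$ with $\lambda$ simple is fixed; on each $\mathfrak V^{(k)}$, $(\bar\lambda^{(k)},\bar v^{(k)})=(\bar\lambda_i^{(k)},\bar v_i^{(k)})$ denotes the Galerkin eigenpair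 whose reciprocal eigenvalue is closest to $1/\lambda$ (in particular $\bar\lambda_i^{(1)}$ is that eigenvalue on $\mathfrak V^{(1)}$), and the computed approximations are the ones closest to these; the gaps $\delta_\lambda^{(k)}:=\min_{j\ne i}|1/\bar\lambda_j^{(k)}-1/\lambda|$ (and the corresponding gaps for the Galerkin problems on the augmented spaces) admit a uniform positive lower bound $\delta_\lambda$; eigenvectors are sign-normalized consistently (nonnegative energy inner product with the target). *)

theory Defs
  imports "HOL-Analysis.Analysis"
begin

text \<open>
  Setting (finite-dimensional, as in the paper): the space V is a finite-dimensional
  real inner product space of type 'v::euclidean_space.  Since V is finite-dimensional
  and dense in V0, V0 = V as sets; the V0 inner product [u,w] is the type's inner
  product  u \<bullet> w  and the V0 norm is  norm.  The energy inner product
  <u,w> = [L u, w] is an abstract symmetric positive definite bilinear form  a.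
\<close>

definition energy_form :: "('v::euclidean_space \<Rightarrow> 'v \<Rightarrow> real) \<Rightarrow> bool" where
  "energy_form a \<longleftrightarrow> bilinear a \<and> (\<forall>u w. a u w = a w u) \<and> (\<forall>u. u \<noteq> 0 \<longrightarrow> a u u > 0)"

definition enorm :: "('v::euclidean_space \<Rightarrow> 'v \<Rightarrow> real) \<Rightarrow> 'v \<Rightarrow> real" where
  "enorm a u = sqrt (a u u)"

definition Linv :: "('v::euclidean_space \<Rightarrow> 'v \<Rightarrow> real) \<Rightarrow> 'v \<Rightarrow> 'v" where
  "Linv a f = (THE u. \<forall>w. a u w = f \<bullet> w)"

definition eta :: "('v::euclidean_space \<Rightarrow> 'v \<Rightarrow> real) \<Rightarrow> 'v set \<Rightarrow> real" where
  "eta a S = (SUP f\<in>{f. norm f = 1}. (INF w\<in>S. enorm a (Linv a f - w)))"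

text \<open>Galerkin eigenpair on a subspace S (S = UNIV gives the exact eigenproblem)\<close>
definition galerkin_eigenpair ::
  "('v::euclidean_space \<Rightarrow> 'v \<Rightarrow> real) \<Rightarrow> 'v set \<Rightarrow> real \<Rightarrow> 'v \<Rightarrow> bool" where
  "galerkin_eigenpair a S \<mu> u \<longleftrightarrow> u \<in> S \<and> a u u = 1 \<and> (\<forall>w\<in>S. a u w = \<mu> * (u \<bullet> w))"

definition closest_pair ::
  "('v::euclidean_space \<Rightarrow> 'v \<Rightarrow> real) \<Rightarrow> 'v set \<Rightarrow> real \<Rightarrow> real \<Rightarrow> 'v \<Rightarrow> bool" where
  "closest_pair a S lam \<mu> u \<longleftrightarrow> galerkin_eigenpair a S \<mu> u \<and>
     (\<forall>\<mu>' u'. galerkin_eigenpair a S \<mu>' u' \<longrightarrow> \<bar>1/\<mu> - 1/lam\<bar> \<le> \<bar>1/\<mu>' - 1/lam\<bar>)"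

text \<open>gap bound: min_{j \<noteq> i} |1/\<mu>_j - 1/lam| \<ge> \<delta>, where the other Galerkin
  eigenvalues \<mu>_j (j \<noteq> i, counted with multiplicity) are exactly the eigenvalues of the
  Galerkin eigenvectors energy-orthogonal to the selected eigenvector u = v_i\<close>
definition gap_bound ::
  "('v::euclidean_space \<Rightarrow> 'v \<Rightarrow> real) \<Rightarrow> 'v set \<Rightarrow> real \<Rightarrow> 'v \<Rightarrow> real \<Rightarrow> bool" where
  "gap_bound a S lam u \<delta> \<longleftrightarrow>
     (\<forall>\<mu>' u'. galerkin_eigenpair a S \<mu>' u' \<and> a u' u = 0 \<longrightarrow> \<delta> \<le> \<bar>1/\<mu>' - 1/lam\<bar>)"

end

theory Submission
  imports Defs
begin

text \<open>
  Since the new iterate solves the Galerkin problem on the augmented space, its energy distance to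
  the energy projection of \<open>vbar\<close> is controlled by the \<open>L2\<close>-type defect
  \<open>lbar vbar - lam_l1 v_l1\<close>, while that projection is at least as good as \<open>vhat\<close>; so the first
  claim follows from the second by absorption. The defect is estimated by Aubin-Nitsche duality
  and by expanding the projection in a Galerkin eigenbasis, where the spectral gap controls all
  components other than \<open>v_l1\<close>. The gap is measured from the exact eigenvalue \<open>lam\<close> instead of
  \<open>lbar\<close>, but the smallness condition already forces every target Galerkin eigenvalue so
  close to \<open>lam\<close> that the stated constants absorb the difference.
\<close>

section \<open>The energy inner product\<close>

locale energy_space =
  fixes a :: "'v::euclidean_space \<Rightarrow> 'v \<Rightarrow> real"
  assumes energy: "energy_form a"
begin

lemma bil: "bilinear a"
  and sym: "a u w = a w u"
  and pos: "u \<noteq> 0 \<Longrightarrow> 0 < a u u"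
  using energy by (auto simp: energy_form_def)

lemmas bil_simps =
  bilinear_ladd[OF bil] bilinear_radd[OF bil] bilinear_lsub[OF bil] bilinear_rsub[OF bil]
  bilinear_lmul[OF bil] bilinear_rmul[OF bil] bilinear_lzero[OF bil] bilinear_rzero[OF bil]

lemma nonneg: "0 \<le> a u u"
  using pos[of u] bil_simps(7)[of 0] by (cases "u = 0") auto

lemma enorm_nonneg: "0 \<le> enorm a u"
  by (simp add: enorm_def nonneg)

lemma enorm_square: "(enorm a u)\<^sup>2 = a u u"
  by (simp add: enorm_def nonneg)

lemma enorm_eq_0: "enorm a u = 0 \<longleftrightarrow> u = 0"
  using pos[of u] by (cases "u = 0") (auto simp: enorm_def bil_simps)

lemma lsum: "a (\<Sum>i\<in>I. f i) w = (\<Sum>i\<in>I. a (f i) w)"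
  using bil linear_sum unfolding bilinear_def by blast

lemma continuous_diag: "continuous_on A (\<lambda>u. a u u)"
  using bounded_bilinear.continuous_on[OF _ continuous_on_id continuous_on_id] bil
    bilinear_conv_bounded_bilinear by blast

text \<open>First-variation principle: for small \<open>t\<close> of sign opposite to
  \<open>b\<close> the linear term would outweigh the quadratic one.\<close>

lemma quadratic_nonneg_imp_linear_zero:
  fixes b c :: real
  assumes "\<And>t. 0 \<le> 2 * t * b + t\<^sup>2 * c"
  shows "b = 0"
proof (rule ccontr)
  assume b: "b \<noteq> 0"
  define t where "t = - b / (\<bar>c\<bar> + 1)"
  have tb: "b = - (t * (\<bar>c\<bar> + 1))" by (simp add: t_def)
  have "2 * t * b + t\<^sup>2 * c = t\<^sup>2 * (c - 2 * (\<bar>c\<bar> + 1))"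
    unfolding tb by algebra
  moreover have "0 < t\<^sup>2" using b tb by auto
  moreover have "c - 2 * (\<bar>c\<bar> + 1) < 0" using abs_ge_self[of c] by (simp add: algebra_simps)
  ultimately show False using assms[of t] by (metis mult_pos_neg not_less)
qed

lemma cauchy_schwarz: "\<bar>a u w\<bar> \<le> enorm a u * enorm a w"
proof (cases "w = 0")
  case True then show ?thesis by (simp add: bil_simps enorm_nonneg)
next
  case False
  define t where "t = a u w / a w w"
  have p: "0 < a w w" using pos False by blast
  have "0 \<le> a (u - t *\<^sub>R w) (u - t *\<^sub>R w)" by (rule nonneg)
  also have "\<dots> = a u u - 2 * t * a u w + t\<^sup>2 * a w w"
    by (simp add: bil_simps sym[of w u] power2_eq_square algebra_simps)
  also have "\<dots> = a u u - (a u w)\<^sup>2 / a w w"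
    using p by (simp add: t_def field_simps power2_eq_square)
  finally have "(a u w)\<^sup>2 \<le> a u u * a w w" using p by (simp add: field_simps)
  then have "\<bar>a u w\<bar>\<^sup>2 \<le> (enorm a u * enorm a w)\<^sup>2"
    by (simp add: power_mult_distrib enorm_square)
  then show ?thesis by (meson enorm_nonneg mult_nonneg_nonneg power2_le_imp_le)
qed

lemma enorm_triangle: "enorm a (u + w) \<le> enorm a u + enorm a w"
proof (rule power2_le_imp_le)
  have "(enorm a (u + w))\<^sup>2 = (enorm a u)\<^sup>2 + 2 * a u w + (enorm a w)\<^sup>2"
    by (simp add: enorm_square bil_simps sym[of w u])
  then show "(enorm a (u + w))\<^sup>2 \<le> (enorm a u + enorm a w)\<^sup>2"
    using cauchy_schwarz[of u w] by (simp add: power2_sum)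
qed (simp add: enorm_nonneg)

lemma enorm_minus_commute: "enorm a (u - w) = enorm a (w - u)"
  by (simp add: enorm_def bil_simps sym algebra_simps)

section \<open>Galerkin eigenbases\<close>

lemma eigenpair_facts:
  assumes "galerkin_eigenpair a S \<mu> u"
  shows "u \<noteq> 0" "0 < \<mu>" "u \<bullet> u = 1 / \<mu>"
proof -
  have 1: "1 = \<mu> * (u \<bullet> u)" using assms by (auto simp: galerkin_eigenpair_def)
  then show "u \<noteq> 0" by auto
  then have "0 < u \<bullet> u" by simp
  with 1 show "0 < \<mu>" by (metis zero_less_mult_pos2 zero_less_one)
  with 1 show "u \<bullet> u = 1 / \<mu>" by (simp add: field_simps)
qed

text \<open>The Rayleigh quotient attains its minimum on the compact unit sphere of
  \<open>S\<close>, and its vanishing first variation there is the eigenvalue equation.\<close>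

lemma eigenpair_exists:
  assumes S: "subspace S" and nz: "S \<noteq> {0}"
  obtains \<mu> u where "galerkin_eigenpair a S \<mu> u"
proof -
  obtain z where z: "z \<in> S" "z \<noteq> 0" using S nz subspace_0 by blast
  define K where "K = S \<inter> sphere 0 1"
  have K: "compact K" unfolding K_def
    by (simp add: closed_subspace[OF S] closed_Int_compact)
  have zK: "z /\<^sub>R norm z \<in> K" using z S by (simp add: K_def subspace_scale)
  obtain m where m: "m \<in> K" "\<And>y. y \<in> K \<Longrightarrow> a m m \<le> a y y"
    using continuous_attains_inf[OF K _ continuous_diag] zK by blast
  have mS: "m \<in> S" and m1: "m \<bullet> m = 1" using m(1) by (auto simp: K_def norm_eq_1)
  define \<mu> where "\<mu> = a m m"
  have \<mu>: "0 < \<mu>" unfolding \<mu>_def using m1 by (intro pos) auto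
  \<comment> \<open>Homogeneity carries minimality from the sphere to all of \<open>S\<close>.
    Equality holds at \<open>m\<close>, so the quadratic in \<open>t\<close> below has no constant
    term.\<close>
  have ray: "0 \<le> a w w - \<mu> * (w \<bullet> w)" if "w \<in> S" for w
  proof (cases "w = 0")
    case True then show ?thesis by (simp add: bil_simps)
  next
    case False
    then have "w /\<^sub>R norm w \<in> K" using that S by (simp add: K_def subspace_scale)
    then have "\<mu> \<le> a (w /\<^sub>R norm w) (w /\<^sub>R norm w)" unfolding \<mu>_def by (rule m(2))
    also have "\<dots> = a w w / (w \<bullet> w)"
      by (simp add: bil_simps dot_square_norm power2_eq_square divide_simps)
    finally show ?thesis using False by (simp add: field_simps)
  qed
  have eig: "a m w = \<mu> * (m \<bullet> w)" if w: "w \<in> S" for w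
  proof -
    have "0 \<le> 2 * t * (a m w - \<mu> * (m \<bullet> w)) + t\<^sup>2 * (a w w - \<mu> * (w \<bullet> w))" for t
    proof -
      have "m + t *\<^sub>R w \<in> S" using mS w S by (simp add: subspace_add subspace_scale)
      from ray[OF this] show ?thesis
        by (simp add: bil_simps inner_simps sym[of w m] inner_commute[of w m] m1 \<mu>_def[symmetric]
            power2_eq_square algebra_simps)
    qed
    then show ?thesis using quadratic_nonneg_imp_linear_zero by fastforce
  qed
  \<comment> \<open>Since \<open>a m m\<close> is \<open>\<mu>\<close>, this scaling gives unit
    energy.\<close>
  have "galerkin_eigenpair a S \<mu> (m /\<^sub>R sqrt \<mu>)"
    using mS S \<mu> eig by (simp add: galerkin_eigenpair_def subspace_scale bil_simps
        \<mu>_def[symmetric] inner_simps field_simps)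
  then show ?thesis by (rule that)
qed

lemma orthogonal_subspace:
  assumes "subspace S"
  shows "subspace {w \<in> S. a w u = 0}"
  using assms by (auto simp: subspace_def bil_simps)

text \<open>Vectors energy-orthogonal to an eigenvector \<open>u\<close> are also orthogonal to it
  for \<open>\<bullet>\<close>, so the \<open>u\<close>-component of a test vector contributes to
  neither side of the eigenvalue equation.\<close>

lemma eigenpair_orthogonal_lift:
  assumes u: "galerkin_eigenpair a S \<mu> u" and S: "subspace S"
    and x: "galerkin_eigenpair a {w \<in> S. a w u = 0} \<nu> x"
  shows "galerkin_eigenpair a S \<nu> x" "a x u = 0"
proof -
  show xu: "a x u = 0" using x by (simp add: galerkin_eigenpair_def)
  have \<mu>: "0 < \<mu>" and uu: "a u u = 1" and uS: "u \<in> S"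
    using eigenpair_facts[OF u] u by (auto simp: galerkin_eigenpair_def)
  have xS: "x \<in> S" using x by (simp add: galerkin_eigenpair_def)
  have "\<mu> * (u \<bullet> x) = a u x" using u xS by (simp add: galerkin_eigenpair_def)
  then have ux: "x \<bullet> u = 0" using xu sym[of u x] \<mu> by (simp add: inner_commute)
  have "a x w = \<nu> * (x \<bullet> w)" if w: "w \<in> S" for w
  proof -
    define w' where "w' = w - a w u *\<^sub>R u"
    have "w' \<in> {w \<in> S. a w u = 0}"
      using w uS S uu by (simp add: w'_def subspace_diff subspace_scale bil_simps)
    then have "a x w' = \<nu> * (x \<bullet> w')" using x by (simp add: galerkin_eigenpair_def)
    then show ?thesis by (simp add: w'_def bil_simps inner_simps xu ux)
  qed
  then show "galerkin_eigenpair a S \<nu> x" using x by (simp add: galerkin_eigenpair_def)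
qed

text \<open>Only the vectors are stored: unit energy forces the eigenvalue of \<open>b\<close> to be
  \<open>1 / (b \<bullet> b)\<close>.\<close>

definition eigenbasis :: "'v set \<Rightarrow> 'v set \<Rightarrow> bool" where
  "eigenbasis S B \<longleftrightarrow> finite B \<and> span B = S \<and> (\<forall>b\<in>B. galerkin_eigenpair a S (1 / (b \<bullet> b)) b)
     \<and> (\<forall>b\<in>B. \<forall>c\<in>B. b \<noteq> c \<longrightarrow> a b c = 0)"

text \<open>Spectral theorem by induction on the dimension: split off one eigenvector, diagonalise
  its energy complement and lift the result.\<close>

lemma eigenbasis_exists:
  assumes "subspace S"
  shows "\<exists>B. eigenbasis S B"
  using assms
proof (induction "dim S" arbitrary: S rule: less_induct)
  case less
  show ?case
  proof (cases "S = {0}")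
    case True
    then have "eigenbasis S {}" by (simp add: eigenbasis_def)
    then show ?thesis by blast
  next
    case False
    then obtain \<mu> u where u: "galerkin_eigenpair a S \<mu> u"
      using eigenpair_exists less.prems by blast
    have uS: "u \<in> S" and uu: "a u u = 1" using u by (auto simp: galerkin_eigenpair_def)
    define S' where "S' = {w \<in> S. a w u = 0}"
    have S': "subspace S'" unfolding S'_def by (rule orthogonal_subspace[OF less.prems])
    have "u \<notin> S'" using uu by (simp add: S'_def)
    then have "S' \<subset> S" using uS by (auto simp: S'_def)
    then have "dim S' < dim S" using less.prems S' by (metis dim_psubset span_eq_iff)
    from less.hyps[OF this S'] obtain B where B: "eigenbasis S' B" by blast
    have lift: "galerkin_eigenpair a S (1 / (b \<bullet> b)) b" "a b u = 0" if "b \<in> B" for b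
      using B that eigenpair_orthogonal_lift[OF u less.prems, of "1 / (b \<bullet> b)" b]
      by (auto simp: eigenbasis_def S'_def)
    have "span (insert u B) = S"
    proof
      have "insert u B \<subseteq> S" using uS lift by (auto simp: galerkin_eigenpair_def)
      then show "span (insert u B) \<subseteq> S" using less.prems by (simp add: span_minimal)
      show "S \<subseteq> span (insert u B)"
      proof
        fix w assume w: "w \<in> S"
        have "w - a w u *\<^sub>R u \<in> S'"
          using w uS less.prems uu by (simp add: S'_def subspace_diff subspace_scale bil_simps)
        then have "w - a w u *\<^sub>R u \<in> span B" using B by (simp add: eigenbasis_def)
        then show "w \<in> span (insert u B)" using span_breakdown_eq by blast
      qed
    qed
    moreover have "galerkin_eigenpair a S (1 / (u \<bullet> u)) u"
      using u eigenpair_facts[OF u] by simp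
    ultimately have "eigenbasis S (insert u B)"
      using B lift lift(2)[unfolded sym[of _ u]] by (auto simp: eigenbasis_def)
    then show ?thesis by blast
  qed
qed

section \<open>Coordinates in a fixed eigenbasis: Parseval and Bessel\<close>

context
  fixes S B assumes B: "eigenbasis S B"
begin

lemma basis_finite: "finite B"
  and basis_in: "b \<in> B \<Longrightarrow> b \<in> S"
  and basis_eigenpair: "b \<in> B \<Longrightarrow> galerkin_eigenpair a S (1 / (b \<bullet> b)) b"
  and basis_orthonormal: "b \<in> B \<Longrightarrow> c \<in> B \<Longrightarrow> a b c = (if b = c then 1 else 0)"
  using B by (auto simp: eigenbasis_def galerkin_eigenpair_def)

lemma basis_inner_pos: "b \<in> B \<Longrightarrow> 0 < b \<bullet> b"
  using eigenpair_facts(1)[OF basis_eigenpair] by simp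

lemma basis_inner: "b \<in> B \<Longrightarrow> w \<in> S \<Longrightarrow> b \<bullet> w = (b \<bullet> b) * a b w"
  using basis_eigenpair[of b] basis_inner_pos[of b] by (simp add: galerkin_eigenpair_def)

lemma coefficient_sum: "b \<in> B \<Longrightarrow> a (\<Sum>c\<in>B. f c *\<^sub>R c) b = f b"
  using basis_finite
  by (simp add: lsum bil_simps basis_orthonormal if_distrib[of "\<lambda>x. _ * x"] sum.delta cong: if_cong)

lemma basis_expansion:
  assumes "w \<in> S"
  shows "w = (\<Sum>b\<in>B. a w b *\<^sub>R b)"
proof -
  have "w \<in> range (\<lambda>f. \<Sum>b\<in>B. f b *\<^sub>R b)"
    using assms B span_finite[OF basis_finite] by (simp add: eigenbasis_def)
  then obtain f where "w = (\<Sum>b\<in>B. f b *\<^sub>R b)" by blast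
  then show ?thesis using coefficient_sum by (simp cong: sum.cong)
qed

lemma parseval:
  assumes "w \<in> S"
  shows "a w w = (\<Sum>b\<in>B. (a w b)\<^sup>2)"
proof -
  have "a w w = a (\<Sum>b\<in>B. a w b *\<^sub>R b) w" using basis_expansion[OF assms] by simp
  also have "\<dots> = (\<Sum>b\<in>B. (a w b)\<^sup>2)"
    by (simp add: lsum bil_simps power2_eq_square sym[of w])
  finally show ?thesis .
qed

lemma parseval_inner:
  assumes w: "w \<in> S"
  shows "w \<bullet> w = (\<Sum>b\<in>B. (b \<bullet> b) * (a w b)\<^sup>2)"
proof -
  have "w \<bullet> w = (\<Sum>b\<in>B. a w b *\<^sub>R b) \<bullet> w" using basis_expansion[OF w] by simp
  also have "\<dots> = (\<Sum>b\<in>B. a w b * (b \<bullet> w))" by (simp add: inner_sum_left)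
  also have "\<dots> = (\<Sum>b\<in>B. (b \<bullet> b) * (a w b)\<^sup>2)"
    by (rule sum.cong) (simp_all add: basis_inner w power2_eq_square sym[of w])
  finally show ?thesis .
qed

text \<open>The eigenvectors are orthogonal for \<open>\<bullet>\<close> too, with squared lengths
  \<open>b \<bullet> b\<close>; this is Bessel's inequality after normalisation, and
  \<open>e\<close> may lie outside \<open>S\<close>.\<close>

lemma bessel: "(\<Sum>b\<in>B. (e \<bullet> b)\<^sup>2 / (b \<bullet> b)) \<le> e \<bullet> e"
proof -
  \<comment> \<open>\<open>s\<close> is the orthogonal projection of \<open>e\<close> onto
    \<open>S\<close> with respect to \<open>\<bullet>\<close>.\<close>
  define s where "s = (\<Sum>b\<in>B. ((e \<bullet> b) / (b \<bullet> b)) *\<^sub>R b)"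
  have subS: "subspace S" using B subspace_span by (auto simp: eigenbasis_def)
  have sS: "s \<in> S" unfolding s_def
    by (intro subspace_sum subS subspace_scale basis_in)
  have es: "e \<bullet> s = (\<Sum>b\<in>B. (e \<bullet> b)\<^sup>2 / (b \<bullet> b))"
    by (simp add: s_def inner_sum_right power2_eq_square)
  have "s \<bullet> s = (\<Sum>b\<in>B. (b \<bullet> b) * ((e \<bullet> b) / (b \<bullet> b))\<^sup>2)"
    unfolding parseval_inner[OF sS] by (rule sum.cong) (simp_all add: s_def coefficient_sum)
  also have "\<dots> = (\<Sum>b\<in>B. (e \<bullet> b)\<^sup>2 / (b \<bullet> b))"
    using basis_inner_pos by (intro sum.cong) (auto simp: power2_eq_square)
  finally have ss: "s \<bullet> s = e \<bullet> s" using es by simp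
  have "0 \<le> (e - s) \<bullet> (e - s)" by simp
  also have "\<dots> = e \<bullet> e - e \<bullet> s" using ss by (simp add: inner_simps inner_commute)
  finally show ?thesis using es by simp
qed

end

section \<open>Poincare inequality, energy projection and solution operator\<close>

lemma poincare:
  assumes "0 < l" and min: "\<And>\<mu> u. galerkin_eigenpair a UNIV \<mu> u \<Longrightarrow> l \<le> \<mu>"
  shows "l * (w \<bullet> w) \<le> a w w"
proof -
  obtain B where B: "eigenbasis UNIV B" using eigenbasis_exists subspace_UNIV by blast
  have "l * (w \<bullet> w) = (\<Sum>b\<in>B. (l * (b \<bullet> b)) * (a w b)\<^sup>2)"
    by (subst parseval_inner[OF B UNIV_I]) (simp add: sum_distrib_left mult.assoc)
  also have "\<dots> \<le> (\<Sum>b\<in>B. 1 * (a w b)\<^sup>2)"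
  proof (intro sum_mono mult_right_mono)
    fix b assume b: "b \<in> B"
    show "l * (b \<bullet> b) \<le> 1"
      using min[OF basis_eigenpair[OF B b]] basis_inner_pos[OF B b] by (simp add: field_simps)
  qed simp
  finally show ?thesis by (simp add: parseval[OF B])
qed

lemma projection_exists:
  assumes "subspace S"
  obtains p where "p \<in> S" "\<And>w. w \<in> S \<Longrightarrow> a (x - p) w = 0"
proof -
  obtain B where B: "eigenbasis S B" using eigenbasis_exists assms by blast
  define p where "p = (\<Sum>b\<in>B. a x b *\<^sub>R b)"
  have "p \<in> S" unfolding p_def
    by (intro subspace_sum assms subspace_scale basis_in[OF B])
  moreover have "a (x - p) w = 0" if "w \<in> S" for w
  proof -
    have "a w (x - p) = (\<Sum>b\<in>B. a w b * a b (x - p))"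
      by (subst (1) basis_expansion[OF B that]) (simp add: lsum bil_simps right_diff_distrib sum_subtractf)
    also have "\<dots> = 0"
      by (rule sum.neutral) (simp add: p_def bil_simps coefficient_sum[OF B] sym[of _ x] sym[of _ "sum _ _"])
    finally show ?thesis by (simp add: sym)
  qed
  ultimately show ?thesis by (rule that)
qed

lemma projection_best:
  assumes S: "subspace S" and p: "p \<in> S" "\<And>w. w \<in> S \<Longrightarrow> a (x - p) w = 0" and w: "w \<in> S"
  shows "enorm a (x - p) \<le> enorm a (x - w)"
proof (rule power2_le_imp_le)
  have "x - w = (x - p) + (p - w)" by simp
  moreover have "a (x - p) (p - w) = 0" using p w S by (auto intro: subspace_diff)
  ultimately have "a (x - w) (x - w) = a (x - p) (x - p) + a (p - w) (p - w)"
    by (simp only: bilinear_ladd[OF bil] bilinear_radd[OF bil] sym[of "p - w" "x - p"])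
  then show "(enorm a (x - p))\<^sup>2 \<le> (enorm a (x - w))\<^sup>2"
    using nonneg[of "p - w"] by (simp add: enorm_square)
qed (rule enorm_nonneg)

text \<open>Justifies the description operator in \<open>Linv\<close>: an eigenbasis of the whole
  space yields the Riesz representative of \<open>f\<close>, and positivity of \<open>a\<close> its
  uniqueness.\<close>

lemma Linv_eq: "a (Linv a f) w = f \<bullet> w"
proof -
  obtain B where B: "eigenbasis UNIV B" using eigenbasis_exists subspace_UNIV by blast
  define u where "u = (\<Sum>b\<in>B. (f \<bullet> b) *\<^sub>R b)"
  have u: "a u w = f \<bullet> w" for w
  proof -
    have "f \<bullet> w = f \<bullet> (\<Sum>b\<in>B. a w b *\<^sub>R b)" using basis_expansion[OF B] by simp
    then show ?thesis
      by (simp add: u_def inner_sum_right lsum bil_simps sym[of w] mult.commute)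
  qed
  have "Linv a f = u" unfolding Linv_def
  proof (rule the_equality)
    fix u' assume "\<forall>w. a u' w = f \<bullet> w"
    then have "a (u' - u) (u' - u) = 0" using u by (simp add: bil_simps)
    then show "u' = u" using pos[of "u' - u"] by auto
  qed (use u in simp)
  then show ?thesis using u by simp
qed

section \<open>Galerkin error estimates\<close>

context
  fixes l :: real
  assumes l: "0 < l" and poinc: "\<And>w. l * (w \<bullet> w) \<le> a w w"
begin

lemma norm_le_enorm: "norm w \<le> enorm a w / sqrt l"
proof -
  have "w \<bullet> w \<le> a w w / l" using poinc[of w] l by (simp add: field_simps)
  then have "sqrt (w \<bullet> w) \<le> sqrt (a w w / l)" by simp
  then show ?thesis by (simp add: enorm_def norm_eq_sqrt_inner real_sqrt_divide)
qed

text \<open>Test with \<open>x\<close> itself and cancel one factor \<open>enorm a x\<close>. This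
  is how load defects in \<open>norm\<close> become energy errors, at the cost of
  \<open>1 / sqrt l\<close>.\<close>

lemma enorm_le_of_weak:
  assumes "\<And>w. w \<in> S \<Longrightarrow> a x w = g \<bullet> w" "x \<in> S"
  shows "enorm a x \<le> norm g / sqrt l"
proof -
  have "(enorm a x)\<^sup>2 = g \<bullet> x" using assms by (simp add: enorm_square)
  also have "\<dots> \<le> norm g * norm x" by (rule norm_cauchy_schwarz)
  also have "\<dots> \<le> norm g * (enorm a x / sqrt l)" by (intro mult_left_mono norm_le_enorm) simp
  finally have "enorm a x * enorm a x \<le> (norm g / sqrt l) * enorm a x"
    by (simp add: power2_eq_square)
  then show ?thesis using enorm_nonneg[of x] l
    by (cases "enorm a x = 0") (auto simp only: mult_le_cancel_right, auto)
qed

text \<open>A real supremum bounds its members only if the set is bounded above; the competitor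
  \<open>0\<close> and the stability of \<open>Linv\<close> ensure this.\<close>

lemma eta_bdd:
  assumes "0 \<in> V"
  shows "bdd_above ((\<lambda>f. INF w\<in>V. enorm a (Linv a f - w)) ` {f. norm f = 1})"
proof (rule bdd_aboveI2)
  fix f :: 'v assume f: "f \<in> {f. norm f = 1}"
  have "bdd_below ((\<lambda>w. enorm a (Linv a f - w)) ` V)" by (rule bdd_belowI2[OF enorm_nonneg])
  then have "(INF w\<in>V. enorm a (Linv a f - w)) \<le> enorm a (Linv a f - 0)"
    using assms by (rule cINF_lower)
  also have "\<dots> \<le> norm f / sqrt l" using enorm_le_of_weak[of UNIV "Linv a f" f] Linv_eq by simp
  finally show "(INF w\<in>V. enorm a (Linv a f - w)) \<le> 1 / sqrt l" using f by simp
qed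

lemma eta_ge:
  assumes V: "0 \<in> V" and f: "norm f = 1" and c: "\<And>w. w \<in> V \<Longrightarrow> c \<le> enorm a (Linv a f - w)"
  shows "c \<le> eta a V"
proof -
  have "c \<le> (INF w\<in>V. enorm a (Linv a f - w))" using V c by (intro cINF_greatest) auto
  also have "\<dots> \<le> eta a V" unfolding eta_def by (rule cSUP_upper[OF _ eta_bdd[OF V]]) (simp add: f)
  finally show ?thesis .
qed

lemma eta_nonneg: "0 \<in> V \<Longrightarrow> 0 \<le> eta a V"
  using eta_ge[of V "SOME b. b \<in> Basis" 0] enorm_nonneg norm_Basis[OF SOME_Basis] by blast

text \<open>Duality: \<open>norm e\<close> is the energy pairing of \<open>e\<close> with the
  solution for the load \<open>e / norm e\<close>, and orthogonality allows any element of
  \<open>V\<close> to be subtracted from that solution.\<close>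

lemma aubin_nitsche:
  assumes V: "0 \<in> V" and orth: "\<And>w. w \<in> V \<Longrightarrow> a e w = 0"
  shows "norm e \<le> eta a V * enorm a e"
proof (cases "e = 0")
  case True then show ?thesis by (simp add: bil_simps enorm_def)
next
  case False
  define f where "f = e /\<^sub>R norm e"
  have f: "norm f = 1" using False by (simp add: f_def)
  have p: "0 < enorm a e" using False enorm_nonneg[of e] enorm_eq_0[of e] by linarith
  have "norm e / enorm a e \<le> enorm a (Linv a f - w)" if "w \<in> V" for w
  proof -
    have "norm e = f \<bullet> e" using False by (simp add: f_def dot_square_norm power2_eq_square)
    also have "\<dots> = a (Linv a f - w) e" using orth[OF that] by (simp add: bil_simps Linv_eq sym[of w e])
    also have "\<dots> \<le> enorm a (Linv a f - w) * enorm a e" by (rule abs_le_D1[OF cauchy_schwarz])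
    finally show ?thesis using p by (simp add: field_simps)
  qed
  then have "norm e / enorm a e \<le> eta a V" by (rule eta_ge[OF V f])
  then show ?thesis using p by (simp add: field_simps)
qed

text \<open>\<open>r\<close> solves a shifted equation for the Galerkin solution operator on
  \<open>S\<close>, whose eigenvalues are the reciprocals \<open>b \<bullet> b\<close>. An
  eigenbasis makes it diagonal, with all factors at least \<open>d\<close> in modulus.\<close>

lemma resolvent_bound:
  assumes S: "subspace S" and r: "r \<in> S" and d: "0 \<le> d"
    and gap: "\<And>\<mu> u. galerkin_eigenpair a S \<mu> u \<Longrightarrow> d \<le> \<bar>1 / \<mu> - \<sigma>\<bar>"
    and res: "\<And>w. w \<in> S \<Longrightarrow> \<sigma> * a r w - r \<bullet> w = e \<bullet> w"
  shows "l * d\<^sup>2 * a r r \<le> e \<bullet> e" "l * d * norm r \<le> norm e"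
proof -
  obtain B where B: "eigenbasis S B" using eigenbasis_exists S by blast
  have coef: "d\<^sup>2 * (a r b)\<^sup>2 \<le> (e \<bullet> b)\<^sup>2" if b: "b \<in> B" for b
  proof -
    have "e \<bullet> b = (\<sigma> - b \<bullet> b) * a r b"
      using res[OF basis_in[OF B b]] basis_inner[OF B b r]
      by (simp add: inner_commute sym algebra_simps)
    moreover have "d \<le> \<bar>\<sigma> - b \<bullet> b\<bar>"
      using gap[OF basis_eigenpair[OF B b]] by (simp add: abs_minus_commute)
    then have "d\<^sup>2 \<le> (\<sigma> - b \<bullet> b)\<^sup>2" using d by (metis abs_of_nonneg power2_le_iff_abs_le power2_abs abs_le_square_iff)
    ultimately show ?thesis by (simp add: power_mult_distrib mult_right_mono)
  qed
  \<comment> \<open>This converts the weights into those of \<open>bessel\<close>; the energy bound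
    uses it once, the norm bound squared.\<close>
  have lb: "l * (b \<bullet> b) \<le> 1" if b: "b \<in> B" for b
    using poinc[of b] basis_orthonormal[OF B b b] by simp
  have "l * d\<^sup>2 * a r r = (\<Sum>b\<in>B. l * (d\<^sup>2 * (a r b)\<^sup>2))"
    by (simp add: parseval[OF B r] sum_distrib_left mult.assoc)
  also have "\<dots> \<le> (\<Sum>b\<in>B. (e \<bullet> b)\<^sup>2 / (b \<bullet> b))"
  proof (rule sum_mono)
    fix b assume b: "b \<in> B"
    have "l * (d\<^sup>2 * (a r b)\<^sup>2) \<le> l * (e \<bullet> b)\<^sup>2" using l coef[OF b] by simp
    also have "\<dots> = l * (b \<bullet> b) * ((e \<bullet> b)\<^sup>2 / (b \<bullet> b))" using basis_inner_pos[OF B b] by simp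
    also have "\<dots> \<le> 1 * ((e \<bullet> b)\<^sup>2 / (b \<bullet> b))" by (intro mult_right_mono lb b) simp
    finally show "l * (d\<^sup>2 * (a r b)\<^sup>2) \<le> (e \<bullet> b)\<^sup>2 / (b \<bullet> b)" by simp
  qed
  also have "\<dots> \<le> e \<bullet> e" by (rule bessel[OF B])
  finally show "l * d\<^sup>2 * a r r \<le> e \<bullet> e" .
  have "(l * d * norm r)\<^sup>2 = (\<Sum>b\<in>B. (l\<^sup>2 * (b \<bullet> b)) * (d\<^sup>2 * (a r b)\<^sup>2))"
    by (simp add: power_mult_distrib dot_square_norm[symmetric] parseval_inner[OF B r] sum_distrib_left mult_ac)
  also have "\<dots> \<le> (\<Sum>b\<in>B. (e \<bullet> b)\<^sup>2 / (b \<bullet> b))"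
  proof (rule sum_mono)
    fix b assume b: "b \<in> B"
    have p: "0 < b \<bullet> b" by (rule basis_inner_pos[OF B b])
    have "(l\<^sup>2 * (b \<bullet> b)) * (d\<^sup>2 * (a r b)\<^sup>2) \<le> (l\<^sup>2 * (b \<bullet> b)) * (e \<bullet> b)\<^sup>2"
      by (intro mult_left_mono coef b) simp
    also have "\<dots> = (l * (b \<bullet> b))\<^sup>2 * ((e \<bullet> b)\<^sup>2 / (b \<bullet> b))"
      using p by (simp add: power2_eq_square)
    also have "\<dots> \<le> 1 * ((e \<bullet> b)\<^sup>2 / (b \<bullet> b))"
      using lb[OF b] p l by (intro mult_right_mono) (auto simp: power_le_one)
    finally show "(l\<^sup>2 * (b \<bullet> b)) * (d\<^sup>2 * (a r b)\<^sup>2) \<le> (e \<bullet> b)\<^sup>2 / (b \<bullet> b)" by simp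
  qed
  also have "\<dots> \<le> e \<bullet> e" by (rule bessel[OF B])
  finally have "(l * d * norm r)\<^sup>2 \<le> (norm e)\<^sup>2" by (simp add: dot_square_norm)
  then show "l * d * norm r \<le> norm e" by (rule power2_le_imp_le) simp
qed

text \<open>For an eigenvector the squared energy error is
  \<open>\<nu> * (x \<bullet> (x - p))\<close>, so duality makes the energy error first order and
  the norm second order in \<open>eta a V\<close>. The last claim presents \<open>p\<close> as an
  approximate eigenvector with residual \<open>x - p\<close>, the form
  \<open>resolvent_bound\<close> takes.\<close>

lemma projection_error:
  assumes x: "galerkin_eigenpair a X \<nu> x" and X: "subspace X" and S: "S \<subseteq> X"
    and V: "V \<subseteq> S" "0 \<in> V"
    and p: "p \<in> S" "\<And>w. w \<in> S \<Longrightarrow> a (x - p) w = 0"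
  shows "norm (x - p) \<le> eta a V * enorm a (x - p)"
    and "enorm a (x - p) \<le> sqrt \<nu> * eta a V"
    and "a p p = 1 - a (x - p) (x - p)"
    and "w \<in> S \<Longrightarrow> 1 / \<nu> * a p w - p \<bullet> w = (x - p) \<bullet> w"
proof -
  let ?e = "x - p"
  have xX: "x \<in> X" and xx: "a x x = 1" and eig: "\<And>w. w \<in> X \<Longrightarrow> a x w = \<nu> * (x \<bullet> w)"
    using x by (auto simp: galerkin_eigenpair_def)
  have \<nu>: "0 < \<nu>" and nx: "x \<bullet> x = 1 / \<nu>" using eigenpair_facts[OF x] by auto
  have eX: "?e \<in> X" using xX p(1) S X by (auto intro: subspace_diff)
  show n: "norm ?e \<le> eta a V * enorm a ?e"
    by (rule aubin_nitsche) (use V p in auto)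
  have ep: "a ?e p = 0" using p by blast
  have xp: "a x p = a p p" using ep by (simp add: bil_simps)
  show "a p p = 1 - a ?e ?e" using xp xx by (simp add: bil_simps sym[of p x])
  have "(enorm a ?e)\<^sup>2 = a x ?e" using ep by (simp add: enorm_square bil_simps sym)
  also have "\<dots> = \<nu> * (x \<bullet> ?e)" by (rule eig[OF eX])
  also have "\<dots> \<le> \<nu> * (norm x * norm ?e)"
    using \<nu> norm_cauchy_schwarz by (intro mult_left_mono) auto
  also have "\<nu> * (norm x * norm ?e) = sqrt \<nu> * norm ?e"
  proof -
    have "norm x = 1 / sqrt \<nu>" using nx by (simp add: norm_eq_sqrt_inner real_sqrt_divide)
    moreover have "\<nu> * (1 / sqrt \<nu>) = sqrt \<nu>" using \<nu> by (simp add: real_div_sqrt)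
    ultimately show ?thesis by (metis mult.assoc)
  qed
  also have "\<dots> \<le> sqrt \<nu> * (eta a V * enorm a ?e)" using n \<nu> by (intro mult_left_mono) auto
  finally have "enorm a ?e * enorm a ?e \<le> (sqrt \<nu> * eta a V) * enorm a ?e"
    by (simp add: power2_eq_square)
  then show "enorm a ?e \<le> sqrt \<nu> * eta a V"
    using enorm_nonneg[of ?e] eta_nonneg[OF V(2)] \<nu>
    by (cases "enorm a ?e = 0") (auto simp only: mult_le_cancel_right, auto)
  show "1 / \<nu> * a p w - p \<bullet> w = ?e \<bullet> w" if w: "w \<in> S" for w
  proof -
    have "a p w = \<nu> * (x \<bullet> w)" using p(2)[OF w] eig[of w] w S by (auto simp: bil_simps)
    then show ?thesis using \<nu> by (simp add: inner_simps)
  qed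
qed

text \<open>The projection of \<open>v\<close> is nearly a Galerkin eigenvector, with residual of
  second order in \<open>eta a V\<close>. No Galerkin reciprocal is nearer to \<open>1 / lam\<close>
  than \<open>1 / \<mu>\<close>, so \<open>resolvent_bound\<close> applies with \<open>d\<close>
  equal to that distance; the factor \<open>1 - lam * (eta a V)\<^sup>2\<close> bounds the energy of
  the projection from below.\<close>

lemma closest_eigenvalue:
  assumes v: "galerkin_eigenpair a UNIV lam v" and S: "subspace S"
    and V: "V \<subseteq> S" "0 \<in> V" and cl: "closest_pair a S lam \<mu> u"
  shows "l * (1 / \<mu> - 1 / lam)\<^sup>2 * (1 - lam * (eta a V)\<^sup>2) \<le> lam * (eta a V)^4"
proof -
  obtain p where p: "p \<in> S" "\<And>w. w \<in> S \<Longrightarrow> a (v - p) w = 0"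
    using projection_exists[OF S] by blast
  note pe = projection_error[OF v subspace_UNIV subset_UNIV V p]
  let ?h = "eta a V" and ?e = "v - p"
  have lam: "0 < lam" using eigenpair_facts[OF v] by auto
  have e2: "a ?e ?e \<le> lam * ?h\<^sup>2"
    using power_mono[OF pe(2) enorm_nonneg, of 2] lam by (simp add: enorm_square power_mult_distrib)
  have "l * \<bar>1 / \<mu> - 1 / lam\<bar>\<^sup>2 * a p p \<le> ?e \<bullet> ?e"
    by (rule resolvent_bound(1)[OF S p(1) _ _ pe(4)])
      (use cl in \<open>auto simp: closest_pair_def\<close>)
  also have "\<dots> \<le> ?h\<^sup>2 * a ?e ?e"
    using power_mono[OF pe(1) norm_ge_zero, of 2]
    by (simp add: enorm_square power_mult_distrib dot_square_norm)
  also have "\<dots> \<le> ?h\<^sup>2 * (lam * ?h\<^sup>2)" by (intro mult_left_mono e2) simp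
  finally have 1: "l * (1 / \<mu> - 1 / lam)\<^sup>2 * a p p \<le> lam * ?h^4"
    by (simp add: power2_eq_square power4_eq_xxxx mult_ac)
  have "1 - lam * ?h\<^sup>2 \<le> a p p" using e2 pe(3) by simp
  then have "l * (1 / \<mu> - 1 / lam)\<^sup>2 * (1 - lam * ?h\<^sup>2) \<le> l * (1 / \<mu> - 1 / lam)\<^sup>2 * a p p"
    using l by (intro mult_left_mono) auto
  with 1 show ?thesis by linarith
qed

text \<open>With \<open>p\<close> the energy projection of \<open>x\<close>, \<open>e = x - p\<close> and \<open>r = p - \<alpha> u\<close>, the difference is
  \<open>\<nu> x - \<mu> u = \<nu> (e - \<mu> (e \<bullet> u) u + r) - \<mu> (1 - \<alpha>) u\<close>; subtracting \<open>\<mu> (e \<bullet> u) u\<close>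
  is an orthogonal projection, so it does not increase the norm of \<open>e\<close>.\<close>

lemma galerkin_eigen_error:
  assumes x: "galerkin_eigenpair a X \<nu> x" and X: "subspace X" and S: "subspace S" "S \<subseteq> X"
    and V: "V \<subseteq> S" "0 \<in> V"
    and u: "galerkin_eigenpair a S \<mu> u" and sgn: "0 \<le> a u x" and d: "0 < d"
    and gap: "\<And>\<mu>' u'. galerkin_eigenpair a S \<mu>' u' \<Longrightarrow> a u' u = 0 \<Longrightarrow> d \<le> \<bar>1 / \<mu>' - 1 / \<nu>\<bar>"
  shows "norm (\<nu> *\<^sub>R x - \<mu> *\<^sub>R u) \<le>
    (\<nu> * (1 + 1 / (l * d)) + sqrt (\<nu> * \<mu>) * sqrt ((1 + (eta a V)\<^sup>2 / (l * d\<^sup>2)) / 2))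
      * eta a V * enorm a (x - u)"
proof -
  obtain p where p: "p \<in> S" "\<And>w. w \<in> S \<Longrightarrow> a (x - p) w = 0"
    using projection_exists[OF S(1)] by blast
  note pe = projection_error[OF x X S(2) V p]
  define e where "e = x - p"
  define h where "h = eta a V"
  define \<alpha> where "\<alpha> = a p u"
  define r where "r = p - \<alpha> *\<^sub>R u"
  define E where "E = enorm a (x - u)"
  have h: "0 \<le> h" unfolding h_def by (rule eta_nonneg[OF V(2)])
  have \<nu>: "0 < \<nu>" and \<mu>: "0 < \<mu>" and nu: "u \<bullet> u = 1 / \<mu>"
    using eigenpair_facts[OF x] eigenpair_facts[OF u] by auto
  have uS: "u \<in> S" and uu: "a u u = 1" and xx: "a x x = 1"
    and eig: "\<And>w. w \<in> S \<Longrightarrow> a u w = \<mu> * (u \<bullet> w)"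
    using u x by (auto simp: galerkin_eigenpair_def)
  have xu: "a x u = \<alpha>" using p(2)[OF uS] by (simp add: \<alpha>_def bil_simps)
  have \<alpha>0: "0 \<le> \<alpha>" using sgn xu sym by metis
  have ru: "a r u = 0" by (simp add: r_def bil_simps uu \<alpha>_def)
  have rS: "r \<in> {w \<in> S. a w u = 0}"
    using ru p(1) uS S(1) by (simp add: r_def subspace_diff subspace_scale)
  \<comment> \<open>On the energy complement of \<open>u\<close> the \<open>\<alpha>\<close>
    component vanishes, so \<open>r\<close> inherits the residual equation of \<open>p\<close>; only
    eigenvalues subject to \<open>gap\<close> remain there.\<close>
  have res: "1 / \<nu> * a r w - r \<bullet> w = e \<bullet> w" if w: "w \<in> {w \<in> S. a w u = 0}" for w
  proof -
    have "a u w = 0" "w \<in> S" using w sym by auto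
    moreover from this have "u \<bullet> w = 0" using eig[of w] \<mu> by simp
    ultimately show ?thesis using pe(4)[of w] by (simp add: r_def e_def bil_simps inner_simps)
  qed
  have gap': "d \<le> \<bar>1 / \<mu>' - 1 / \<nu>\<bar>" if "galerkin_eigenpair a {w \<in> S. a w u = 0} \<mu>' u'" for \<mu>' u'
    using gap eigenpair_orthogonal_lift[OF u S(1) that] by blast
  have rb: "l * d\<^sup>2 * a r r \<le> e \<bullet> e" "l * d * norm r \<le> norm e"
    using resolvent_bound[OF orthogonal_subspace[OF S(1)] rS less_imp_le[OF d], of "1 / \<nu>" e] gap' res
    by blast+
  have en: "norm e \<le> h * enorm a e" using pe(1) by (simp add: e_def h_def)
  have rn: "norm r \<le> norm e / (l * d)" using rb(2) l d by (simp add: field_simps)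
  have xp: "a (x - u) (x - u) = 2 * (1 - \<alpha>)" using xx uu xu by (simp add: bil_simps sym[of u x])
  then have E2: "E\<^sup>2 = 2 * (1 - \<alpha>)" by (simp add: E_def enorm_square)
  have \<alpha>1: "\<alpha> \<le> 1" using zero_le_power2[of E] unfolding E2 by simp
  have pp: "a p p = \<alpha>\<^sup>2 + a r r"
  proof -
    have "p = r + \<alpha> *\<^sub>R u" by (simp add: r_def)
    then show ?thesis using ru by (simp add: bil_simps sym[of u r] uu power2_eq_square)
  qed
  have eE: "enorm a e \<le> E" using projection_best[OF S(1) p uS] by (simp add: e_def E_def)
  have Q: "norm (e - (\<mu> * (e \<bullet> u)) *\<^sub>R u) \<le> norm e"
  proof -
    have "(norm (e - (\<mu> * (e \<bullet> u)) *\<^sub>R u))\<^sup>2 = e \<bullet> e - \<mu> * (e \<bullet> u)\<^sup>2"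
      unfolding power2_norm_eq_inner
      using \<mu> nu by (simp add: inner_simps inner_commute[of u e] power2_eq_square algebra_simps)
    also have "\<dots> \<le> (norm e)\<^sup>2" using \<mu> by (simp add: dot_square_norm)
    finally show ?thesis by (rule power2_le_imp_le) simp
  qed
  have eq: "\<nu> *\<^sub>R x - \<mu> *\<^sub>R u = \<nu> *\<^sub>R (e - (\<mu> * (e \<bullet> u)) *\<^sub>R u + r) - (\<mu> * (1 - \<alpha>)) *\<^sub>R u"
  proof -
    have "p \<bullet> u = \<alpha> / \<mu>" using eig[OF p(1)] \<mu> by (simp add: \<alpha>_def sym[of p u] inner_commute)
    then have "e \<bullet> u = \<alpha> / \<nu> - \<alpha> / \<mu>" using pe(4)[OF _ uS] by (simp add: e_def \<alpha>_def)
    then have c: "\<nu> * (\<mu> * (e \<bullet> u)) = \<mu> * \<alpha> - \<nu> * \<alpha>" using \<nu> \<mu> by (simp add: field_simps)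
    have "\<nu> *\<^sub>R (e - (\<mu> * (e \<bullet> u)) *\<^sub>R u + r) - (\<mu> * (1 - \<alpha>)) *\<^sub>R u
        = \<nu> *\<^sub>R (e + r) - (\<nu> * (\<mu> * (e \<bullet> u)) + \<mu> * (1 - \<alpha>)) *\<^sub>R u"
      by (simp add: algebra_simps)
    also have "\<dots> = \<nu> *\<^sub>R x - \<mu> *\<^sub>R u" unfolding c by (simp add: e_def r_def algebra_simps)
    finally show ?thesis by simp
  qed
  have "norm (\<nu> *\<^sub>R x - \<mu> *\<^sub>R u) \<le> \<nu> * (norm e + norm r) + \<mu> * (1 - \<alpha>) * norm u"
  proof -
    have "norm (e - (\<mu> * (e \<bullet> u)) *\<^sub>R u + r) \<le> norm e + norm r"
      using Q norm_triangle_ineq[of "e - (\<mu> * (e \<bullet> u)) *\<^sub>R u" r] by linarith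
    then have "\<nu> * norm (e - (\<mu> * (e \<bullet> u)) *\<^sub>R u + r) \<le> \<nu> * (norm e + norm r)"
      using \<nu> by (intro mult_left_mono) auto
    moreover have "norm ((\<mu> * (1 - \<alpha>)) *\<^sub>R u) = \<mu> * (1 - \<alpha>) * norm u" using \<mu> \<alpha>1 by simp
    moreover have "norm (\<nu> *\<^sub>R (e - (\<mu> * (e \<bullet> u)) *\<^sub>R u + r)) = \<nu> * norm (e - (\<mu> * (e \<bullet> u)) *\<^sub>R u + r)"
      using \<nu> by simp
    ultimately show ?thesis unfolding eq
      using norm_triangle_ineq4[of "\<nu> *\<^sub>R (e - (\<mu> * (e \<bullet> u)) *\<^sub>R u + r)" "(\<mu> * (1 - \<alpha>)) *\<^sub>R u"]
      by linarith
  qed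
  also have "\<nu> * (norm e + norm r) \<le> \<nu> * (1 + 1 / (l * d)) * h * E"
  proof -
    have "norm e + norm r \<le> (1 + 1 / (l * d)) * norm e" using rn by (simp add: algebra_simps)
    also have "\<dots> \<le> (1 + 1 / (l * d)) * (h * E)"
      using en eE h l d by (intro mult_left_mono) (auto intro: order_trans mult_left_mono)
    finally show ?thesis using \<nu> by (simp add: mult.assoc)
  qed
  also have "\<mu> * (1 - \<alpha>) * norm u
      \<le> sqrt (\<nu> * \<mu>) * sqrt ((1 + h\<^sup>2 / (l * d\<^sup>2)) / 2) * h * E"
  proof -
    have "norm u = 1 / sqrt \<mu>" using nu by (simp add: norm_eq_sqrt_inner real_sqrt_divide)
    then have "\<mu> * norm u = sqrt \<mu>" using \<mu> by (simp add: real_div_sqrt)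
    then have 1: "\<mu> * (1 - \<alpha>) * norm u = sqrt \<mu> * (1 - \<alpha>)" by (metis mult.assoc mult.commute)
    have "e \<bullet> e \<le> h\<^sup>2 * a e e"
      using power_mono[OF en norm_ge_zero, of 2] by (simp add: power_mult_distrib enorm_square dot_square_norm)
    then have "l * d\<^sup>2 * a r r \<le> h\<^sup>2 * a e e" using rb(1) by linarith
    then have rr: "a r r \<le> h\<^sup>2 / (l * d\<^sup>2) * a e e" using l d by (simp add: field_simps)
    \<comment> \<open>The sign normalisation gives \<open>0 \<le> \<alpha>\<close>. The quantity
      \<open>1 - \<alpha>\<^sup>2\<close> is the energy of \<open>x\<close> outside the direction
      \<open>u\<close>, which splits into the parts \<open>e\<close> and \<open>r\<close>.\<close>
    have "1 - \<alpha> \<le> 1 - \<alpha>\<^sup>2" using \<alpha>0 \<alpha>1 by (simp add: power2_eq_square mult_left_le)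
    also have "\<dots> = a e e + a r r" using pe(3) pp by (simp add: e_def)
    also have "\<dots> \<le> (1 + h\<^sup>2 / (l * d\<^sup>2)) * a e e" using rr by (simp add: algebra_simps)
    finally have 2: "1 - \<alpha> \<le> (1 + h\<^sup>2 / (l * d\<^sup>2)) * (enorm a e)\<^sup>2" by (simp add: enorm_square)
    \<comment> \<open>One factor becomes \<open>E\<^sup>2 / 2\<close>, the other its bound. The root
      then keeps one \<open>E\<close> and one \<open>enorm a e\<close>, which is of order
      \<open>h\<close>; hence the halving inside the sharp constant.\<close>
    have "(1 - \<alpha>)\<^sup>2 = (1 - \<alpha>) * (E\<^sup>2 / 2)" using E2 by (simp add: power2_eq_square)
    also have "\<dots> \<le> ((1 + h\<^sup>2 / (l * d\<^sup>2)) * (enorm a e)\<^sup>2) * (E\<^sup>2 / 2)"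
      using 2 by (intro mult_right_mono) auto
    also have "\<dots> = (sqrt ((1 + h\<^sup>2 / (l * d\<^sup>2)) / 2) * enorm a e * E)\<^sup>2"
      using l by (simp add: power_mult_distrib)
    finally have "1 - \<alpha> \<le> sqrt ((1 + h\<^sup>2 / (l * d\<^sup>2)) / 2) * enorm a e * E"
      by (rule power2_le_imp_le) (use l in \<open>auto simp: E_def enorm_nonneg\<close>)
    also have "\<dots> \<le> sqrt ((1 + h\<^sup>2 / (l * d\<^sup>2)) / 2) * (sqrt \<nu> * h) * E"
      using pe(2) l by (intro mult_right_mono mult_left_mono) (auto simp: e_def h_def E_def enorm_nonneg)
    finally have "sqrt \<mu> * (1 - \<alpha>) \<le> sqrt \<mu> * (sqrt ((1 + h\<^sup>2 / (l * d\<^sup>2)) / 2) * (sqrt \<nu> * h) * E)"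
      using \<mu> by (intro mult_left_mono) auto
    then show ?thesis unfolding 1 by (simp add: real_sqrt_mult mult_ac)
  qed
  finally show ?thesis by (simp add: h_def E_def algebra_simps)
qed

text \<open>On \<open>S\<close>, the energy projection of \<open>x\<close> and the vector
  \<open>u\<close> solve the same linear problem with loads \<open>\<nu> *\<^sub>R x\<close> and
  \<open>\<mu> *\<^sub>R u\<close>, so stability bounds their distance; the projection is at least
  as good as \<open>w\<close>.\<close>

lemma galerkin_quasi_optimal:
  assumes x: "galerkin_eigenpair a X \<nu> x" and S: "subspace S" "S \<subseteq> X"
    and u: "galerkin_eigenpair a S \<mu> u" and w: "w \<in> S"
  shows "enorm a (x - u) \<le> enorm a (x - w) + norm (\<nu> *\<^sub>R x - \<mu> *\<^sub>R u) / sqrt l"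
proof -
  obtain p where p: "p \<in> S" "\<And>w. w \<in> S \<Longrightarrow> a (x - p) w = 0"
    using projection_exists[OF S(1)] by blast
  have "enorm a (p - u) \<le> norm (\<nu> *\<^sub>R x - \<mu> *\<^sub>R u) / sqrt l"
  proof (rule enorm_le_of_weak)
    fix z assume z: "z \<in> S"
    have "a p z = \<nu> * (x \<bullet> z)" "a u z = \<mu> * (u \<bullet> z)"
      using p(2)[OF z] x u z S(2) by (auto simp: galerkin_eigenpair_def bil_simps)
    then show "a (p - u) z = (\<nu> *\<^sub>R x - \<mu> *\<^sub>R u) \<bullet> z" by (simp add: bil_simps inner_simps)
  next
    show "p - u \<in> S" using p(1) u S(1) by (auto simp: galerkin_eigenpair_def intro: subspace_diff)
  qed
  moreover have "enorm a (x - p) \<le> enorm a (x - w)" by (rule projection_best[OF S(1) p w])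
  moreover have "enorm a (x - u) \<le> enorm a (x - p) + enorm a (p - u)"
    using enorm_triangle[of "x - p" "p - u"] by simp
  ultimately show ?thesis by linarith
qed

text \<open>\<open>x\<close> and \<open>t\<close> solve the same linear problem on \<open>X\<close>
  with loads \<open>\<nu> *\<^sub>R x\<close> and \<open>\<mu> *\<^sub>R y\<close>; the rest is the
  triangle inequality through \<open>t\<close>.\<close>

lemma inexact_solve_error:
  assumes x: "galerkin_eigenpair a X \<nu> x" and X: "subspace X"
    and t: "t \<in> X" "\<And>w. w \<in> X \<Longrightarrow> a t w = \<mu> * (y \<bullet> w)"
    and z: "enorm a (z - t) \<le> \<theta> * enorm a (y - t)" "0 \<le> \<theta>"
  shows "enorm a (x - z) \<le>
    \<theta> * enorm a (x - y) + (1 + \<theta>) * (norm (\<nu> *\<^sub>R x - \<mu> *\<^sub>R y) / sqrt l)"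
proof -
  have xt: "enorm a (x - t) \<le> norm (\<nu> *\<^sub>R x - \<mu> *\<^sub>R y) / sqrt l"
  proof (rule enorm_le_of_weak)
    show "x - t \<in> X" using x X t(1) by (auto simp: galerkin_eigenpair_def intro: subspace_diff)
    show "a (x - t) w = (\<nu> *\<^sub>R x - \<mu> *\<^sub>R y) \<bullet> w" if "w \<in> X" for w
      using x t(2)[OF that] that by (simp add: galerkin_eigenpair_def bil_simps inner_simps)
  qed
  have "enorm a (x - z) \<le> enorm a (x - t) + enorm a (z - t)"
    using enorm_triangle[of "x - t" "t - z"] by (simp add: enorm_minus_commute[of t z])
  moreover have "enorm a (y - t) \<le> enorm a (x - y) + enorm a (x - t)"
    using enorm_triangle[of "y - x" "x - t"] by (simp add: enorm_minus_commute[of y x])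
  then have "\<theta> * enorm a (y - t) \<le> \<theta> * (enorm a (x - y) + enorm a (x - t))"
    using z(2) by (rule mult_left_mono)
  ultimately have "enorm a (x - z) \<le> \<theta> * enorm a (x - y) + (1 + \<theta>) * enorm a (x - t)"
    using z(1) by (simp add: algebra_simps)
  also have "\<dots> \<le> \<theta> * enorm a (x - y) + (1 + \<theta>) * (norm (\<nu> *\<^sub>R x - \<mu> *\<^sub>R y) / sqrt l)"
    using xt z(2) by (intro add_left_mono mult_left_mono) auto
  finally show ?thesis .
qed

end

end

section \<open>Consequences of the smallness condition\<close>

text \<open>All Galerkin problems on spaces containing the coarse one have their target eigenvalue
  so close to \<open>lam\<close> that replacing \<open>lam\<close> by it costs only the
  slack between the sharp constant of \<open>galerkin_eigen_error\<close> and the claimed one.\<close>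

lemma small_imp_mesh_bound:
  fixes l lam \<delta> h lb :: real
  assumes l: "0 < l" "0 < lam" "0 < \<delta>" "0 \<le> h" "0 < lb"
    and small: "(1 / sqrt l) * (2 * \<bar>lam\<bar> * (1 + 1 / (l * \<delta>)) + lb * s) * h < 1" and s: "0 \<le> s"
  shows "4 * lam\<^sup>2 * (1 + 1 / (l * \<delta>))\<^sup>2 * h\<^sup>2 \<le> l"
proof -
  \<comment> \<open>Only the first summand of the constant is kept.\<close>
  have "(1 / sqrt l) * (2 * lam * (1 + 1 / (l * \<delta>))) * h \<le> (1 / sqrt l) * (2 * \<bar>lam\<bar> * (1 + 1 / (l * \<delta>)) + lb * s) * h"
    using l s by (intro mult_right_mono mult_left_mono) auto
  then have "(1 / sqrt l) * (2 * lam * (1 + 1 / (l * \<delta>))) * h \<le> 1" using small by linarith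
  then have "2 * lam * (1 + 1 / (l * \<delta>)) * h \<le> sqrt l" using l by (simp add: field_simps)
  then have "(2 * lam * (1 + 1 / (l * \<delta>)) * h)\<^sup>2 \<le> (sqrt l)\<^sup>2"
    using l by (intro power_mono) auto
  then show ?thesis using l by (simp add: power_mult_distrib)
qed

text \<open>Both bounds follow from \<open>D * z \<le> 3/10\<close>, because \<open>z\<close>
  dominates \<open>lam\<close> as well as \<open>4 / \<delta>\<close>.\<close>

lemma mesh_bound_imp_close:
  fixes l lam \<delta> h \<nu> :: real
  assumes l: "0 < l" "l \<le> lam" "0 < \<delta>"
    and mesh: "4 * lam\<^sup>2 * (1 + 1 / (l * \<delta>))\<^sup>2 * h\<^sup>2 \<le> l"
    and cl: "l * (1 / \<nu> - 1 / lam)\<^sup>2 * (1 - lam * h\<^sup>2) \<le> lam * h ^ 4"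
  shows "\<bar>1 / \<nu> - 1 / lam\<bar> \<le> 3/10 / lam" "\<bar>1 / \<nu> - 1 / lam\<bar> \<le> \<delta> / 10"
proof -
  define y where "y = 1 / (l * \<delta>)"
  define t where "t = h\<^sup>2"
  define D where "D = \<bar>1 / \<nu> - 1 / lam\<bar>"
  define z where "z = lam * (1 + y)\<^sup>2"
  have lam: "0 < lam" using l by linarith
  have y: "0 < y" using l by (simp add: y_def)
  have t: "0 \<le> t" by (simp add: t_def)
  have D0: "0 \<le> D" by (simp add: D_def)
  have y1: "1 \<le> (1 + y)\<^sup>2" using y by simp
  have zl: "lam \<le> z" using mult_left_mono[OF y1, of lam] lam by (simp add: z_def)
  have tz: "4 * (t * z) * lam \<le> l"
  proof -
    have "4 * (t * z) * lam = 4 * lam\<^sup>2 * (1 + y)\<^sup>2 * h\<^sup>2" unfolding t_def z_def by algebra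
    then show ?thesis using mesh by (simp add: y_def)
  qed
  have "4 * (t * z) * lam \<le> lam" using tz l by linarith
  then have tz1: "4 * (t * z) \<le> 1" using lam by simp
  have "t * lam \<le> t * z" using zl t by (rule mult_left_mono)
  then have "3/4 \<le> 1 - lam * t" using tz1 by (simp add: mult.commute)
  then have "l * D\<^sup>2 * (3/4) \<le> l * D\<^sup>2 * (1 - lam * t)" using l by (intro mult_left_mono) auto
  also have "\<dots> \<le> lam * t\<^sup>2" using cl by (simp add: D_def t_def flip: power_mult)
  finally have "l * D\<^sup>2 * (3/4) * z\<^sup>2 \<le> lam * t\<^sup>2 * z\<^sup>2" by (rule mult_right_mono) simp
  also have "\<dots> = (4 * (t * z) * lam) * (4 * (t * z)) / 16" by (simp add: power2_eq_square)
  also have "\<dots> \<le> (l * 1) / 16"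
    using tz tz1 t zl lam l by (intro divide_right_mono mult_mono) auto
  finally have "l * ((D * z)\<^sup>2 * 12) \<le> l * 1" by (simp add: power_mult_distrib)
  then have "(D * z)\<^sup>2 * 12 \<le> 1" using l by simp
  \<comment> \<open>\<open>1/12\<close> is below \<open>9/100\<close>.\<close>
  then have "(D * z)\<^sup>2 \<le> (3/10)\<^sup>2" by (simp add: power2_eq_square)
  then have Dz: "D * z \<le> 3/10" by (rule power2_le_imp_le) simp
  have "D * lam \<le> D * z" using zl D0 by (rule mult_left_mono)
  then have "D * lam \<le> 3/10" using Dz by linarith
  then have "D \<le> 3/10 / lam" using lam by (simp add: field_simps)
  then show "\<bar>1 / \<nu> - 1 / lam\<bar> \<le> 3/10 / lam" unfolding D_def .
  \<comment> \<open>The inequality \<open>4 * y \<le> (1 + y)\<^sup>2\<close> brings in the gap,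
    since \<open>l * y\<close> is \<open>1 / \<delta>\<close>.\<close>
  have "0 \<le> (1 - y)\<^sup>2" by simp
  then have "4 * y \<le> (1 + y)\<^sup>2" by (simp add: power2_eq_square algebra_simps)
  then have "lam * (4 * y) \<le> z" unfolding z_def using lam by (intro mult_left_mono) auto
  moreover have "l * (4 * y) \<le> lam * (4 * y)" using l y by (intro mult_right_mono) auto
  moreover have "l * (4 * y) = 4 / \<delta>" using l by (simp add: y_def)
  ultimately have "4 / \<delta> \<le> z" by linarith
  then have "D * (4 / \<delta>) \<le> D * z" using D0 by (rule mult_left_mono)
  then have "D * (4 / \<delta>) \<le> 3/10" using Dz by linarith
  then have "D * 4 \<le> 3/10 * \<delta>" using l by (simp add: field_simps)
  then show "\<bar>1 / \<nu> - 1 / lam\<bar> \<le> \<delta> / 10" using l unfolding D_def[symmetric] by linarith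
qed

text \<open>Closeness gives \<open>\<nu>\<close> and \<open>\<mu>\<close> at most
  \<open>10/7 * lam\<close> and \<open>lb\<close> at least \<open>10/13 * lam\<close>; the root on
  the right is at least \<open>1\<close>. Comparing multiples of \<open>lam\<close> and of
  \<open>lam * y\<close>, \<open>10/7 * 181/100\<close> is below \<open>2 + 10/13\<close>, and
  \<open>100/63\<close> below \<open>2\<close>.\<close>

lemma constant_comparison:
  fixes l lam \<delta> h \<nu> \<mu> lb :: real
  assumes l: "0 < l" "l \<le> lam" "0 < \<delta>"
    and mesh: "4 * lam\<^sup>2 * (1 + 1 / (l * \<delta>))\<^sup>2 * h\<^sup>2 \<le> l"
    and pos: "0 < \<nu>" "0 < \<mu>" "0 < lb"
    and close: "\<bar>1 / \<nu> - 1 / lam\<bar> \<le> 3/10 / lam" "\<bar>1 / \<mu> - 1 / lam\<bar> \<le> 3/10 / lam"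
      "\<bar>1 / lb - 1 / lam\<bar> \<le> 3/10 / lam"
  shows "\<nu> * (1 + 1 / (l * (9/10 * \<delta>))) + sqrt (\<nu> * \<mu>) * sqrt ((1 + h\<^sup>2 / (l * (9/10 * \<delta>)\<^sup>2)) / 2)
    \<le> 2 * \<bar>lam\<bar> * (1 + 1 / (l * \<delta>)) + lb * sqrt (1 + 1 / (l * \<delta>\<^sup>2) * h\<^sup>2)"
proof -
  define y where "y = 1 / (l * \<delta>)"
  have lam: "0 < lam" using l by linarith
  have y: "0 < y" using l by (simp add: y_def)
  have up: "\<kappa> \<le> 10/7 * lam" if "\<bar>1 / \<kappa> - 1 / lam\<bar> \<le> 3/10 / lam" "0 < \<kappa>" for \<kappa> :: real
  proof -
    have "7/10 / lam \<le> 1 / \<kappa>" using that(1) by (simp add: abs_le_iff)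
    then show ?thesis using lam that(2) by (simp add: field_simps)
  qed
  have "1 / lb \<le> 13/10 / lam" using close(3) by (simp add: abs_le_iff)
  then have lb: "10/13 * lam \<le> lb" using lam pos by (simp add: field_simps)
  have \<nu>: "\<nu> \<le> 10/7 * lam" and \<mu>: "\<mu> \<le> 10/7 * lam" using up close pos by auto
  have "h\<^sup>2 / (l * \<delta>\<^sup>2) \<le> 1/4"
  proof -
    have "l * y \<le> lam * (1 + y)" using l y lam by (intro mult_mono) auto
    then have "(1 / \<delta>)\<^sup>2 \<le> (lam * (1 + y))\<^sup>2" using l by (intro power_mono) (auto simp: y_def)
    then have "(1 / \<delta>)\<^sup>2 * h\<^sup>2 \<le> (lam * (1 + y))\<^sup>2 * h\<^sup>2" by (rule mult_right_mono) simp
    then have "4 * ((1 / \<delta>)\<^sup>2 * h\<^sup>2) \<le> l" using mesh by (simp add: y_def power_mult_distrib)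
    then show ?thesis using l by (simp add: field_simps)
  qed
  \<comment> \<open>The left side is at most \<open>53/81\<close>, just under
    \<open>6561/10000\<close>.\<close>
  then have "(1 + h\<^sup>2 / (l * (9/10 * \<delta>)\<^sup>2)) / 2 \<le> (81/100)\<^sup>2"
    by (simp add: power2_eq_square field_simps)
  then have "sqrt ((1 + h\<^sup>2 / (l * (9/10 * \<delta>)\<^sup>2)) / 2) \<le> 81/100" by (rule real_le_lsqrt[rotated]) simp
  moreover have "sqrt (\<nu> * \<mu>) \<le> 10/7 * lam"
  proof (rule real_le_lsqrt[rotated])
    show "\<nu> * \<mu> \<le> (10/7 * lam)\<^sup>2" unfolding power2_eq_square using \<nu> \<mu> pos lam by (intro mult_mono) auto
  qed (use lam in simp)
  ultimately have 1: "sqrt (\<nu> * \<mu>) * sqrt ((1 + h\<^sup>2 / (l * (9/10 * \<delta>)\<^sup>2)) / 2) \<le> (10/7 * lam) * (81/100)"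
    using lam l by (intro mult_mono) auto
  have "1 + 1 / (l * (9/10 * \<delta>)) = 1 + 10/9 * y" by (simp add: y_def)
  then have 2: "\<nu> * (1 + 1 / (l * (9/10 * \<delta>))) \<le> (10/7 * lam) * (1 + 10/9 * y)"
    using \<nu> y by (simp only:) (intro mult_right_mono, auto)
  have "lb * 1 \<le> lb * sqrt (1 + 1 / (l * \<delta>\<^sup>2) * h\<^sup>2)" using pos l by (intro mult_left_mono) auto
  moreover have "0 \<le> lam * y" using lam y by simp
  moreover have "2 * \<bar>lam\<bar> * (1 + 1 / (l * \<delta>)) = 2 * lam + 2 * (lam * y)"
    using lam by (simp add: y_def algebra_simps)
  moreover have "(10/7 * lam) * (1 + 10/9 * y) = 10/7 * lam + 100/63 * (lam * y)"
    by (simp add: algebra_simps)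
  ultimately show ?thesis using 1 2 lb lam by linarith
qed

section \<open>Contraction of one augmented-subspace correction step\<close>

theorem theorem3:
  fixes a :: "'v::euclidean_space \<Rightarrow> 'v \<Rightarrow> real"
    and Vs :: "nat \<Rightarrow> 'v set" and q k :: nat
    and lam lam1 :: real and v v1 :: 'v
    and lbar lbar1 :: real and vbar vbar1 :: 'v
    and \<delta> C1 \<theta> :: real
    and lam_l lam_l1 :: real and v_l v_l1 vtil vhat :: 'v
  defines "\<eta>1 \<equiv> eta a (Vs 1)"
    and "V1k \<equiv> span (insert vhat (Vs 1))"
  assumes a: "energy_form a"
    \<comment> \<open>nested subspaces V^(1) \<subseteq> ... \<subseteq> V^(q)\<close>
    and Vsub: "\<And>j. 1 \<le> j \<Longrightarrow> j \<le> q \<Longrightarrow> subspace (Vs j)"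
    and Vnest: "\<And>j. 1 \<le> j \<Longrightarrow> j < q \<Longrightarrow> Vs j \<subseteq> Vs (Suc j)"
    and k: "1 \<le> k" "k \<le> q"
    \<comment> \<open>exact target eigenpair, simple eigenvalue; smallest exact eigenvalue lam1\<close>
    and exact: "galerkin_eigenpair a UNIV lam v"
    and simple: "\<And>\<mu> u. galerkin_eigenpair a UNIV \<mu> u \<Longrightarrow> a u v = 0 \<Longrightarrow> \<mu> \<noteq> lam"
    and lam1: "galerkin_eigenpair a UNIV lam1 v1" "\<And>\<mu> u. galerkin_eigenpair a UNIV \<mu> u \<Longrightarrow> lam1 \<le> \<mu>"
    \<comment> \<open>uniform gap bound\<close>
    and \<delta>: "\<delta> > 0"
    \<comment> \<open>target Galerkin eigenpair on V^(1)\<close>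
    and bar1: "closest_pair a (Vs 1) lam lbar1 vbar1" "gap_bound a (Vs 1) lam vbar1 \<delta>" "a vbar1 v \<ge> 0"
    \<comment> \<open>target Galerkin eigenpair on V^(k)\<close>
    and bark: "closest_pair a (Vs k) lam lbar vbar" "gap_bound a (Vs k) lam vbar \<delta>" "a vbar v \<ge> 0"
    \<comment> \<open>current iterate\<close>
    and vl: "v_l \<in> Vs k" "enorm a v_l = 1"
    and C1: "C1 \<ge> 0"
    and hypl: "norm (lbar *\<^sub>R vbar - lam_l *\<^sub>R v_l) \<le> C1 * \<eta>1 * enorm a (vbar - v_l)"
    \<comment> \<open>exact solve and multigrid approximation\<close>
    and vtil: "vtil \<in> Vs k" "\<And>w. w \<in> Vs k \<Longrightarrow> a vtil w = lam_l * (v_l \<bullet> w)"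
    and vhat: "vhat \<in> Vs k" "enorm a (vhat - vtil) \<le> \<theta> * enorm a (v_l - vtil)"
    and \<theta>: "0 \<le> \<theta>" "\<theta> < 1"
    \<comment> \<open>new iterate: target Galerkin eigenpair on augmented space V^(1,k)\<close>
    and new: "closest_pair a V1k lam lam_l1 v_l1" "gap_bound a V1k lam v_l1 \<delta>" "a v_l1 vbar \<ge> 0"
    and small: "(1 / sqrt lam1) * (2 * \<bar>lam\<bar> * (1 + 1 / (lam1 * \<delta>))
                 + lbar1 * sqrt (1 + 1 / (lam1 * \<delta>\<^sup>2) * \<eta>1\<^sup>2)) * \<eta>1 < 1"
  shows "enorm a (vbar - v_l1) \<le>
           (1 / (1 - (1 / sqrt lam1) * (2 * \<bar>lam\<bar> * (1 + 1 / (lam1 * \<delta>))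
                 + lbar1 * sqrt (1 + 1 / (lam1 * \<delta>\<^sup>2) * \<eta>1\<^sup>2)) * \<eta>1))
           * (\<theta> + (1 + \<theta>) * (C1 / sqrt lam1) * \<eta>1) * enorm a (vbar - v_l) \<and>
         norm (lbar *\<^sub>R vbar - lam_l1 *\<^sub>R v_l1) \<le>
           (2 * \<bar>lam\<bar> * (1 + 1 / (lam1 * \<delta>)) + lbar1 * sqrt (1 + 1 / (lam1 * \<delta>\<^sup>2) * \<eta>1\<^sup>2))
           * \<eta>1 * enorm a (vbar - v_l1)"
proof -
  interpret energy_space a by unfold_locales (rule a)
  have Vmono: "Vs 1 \<subseteq> Vs j" if "1 \<le> j" "j \<le> q" for j
    using that
  proof (induction j rule: dec_induct)
    case (step n)
    then show ?case using Vnest[of n] by auto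
  qed simp
  have sub1: "subspace (Vs 1)" and subk: "subspace (Vs k)" using Vsub k by auto
  have subW: "subspace V1k" by (simp add: V1k_def)
  have V0: "0 \<in> Vs 1" by (rule subspace_0[OF sub1])
  have V1W: "Vs 1 \<subseteq> V1k" unfolding V1k_def using span_superset by blast
  \<comment> \<open>With \<open>V1k\<close> between \<open>Vs 1\<close> and \<open>Vs k\<close>,
    \<open>vbar\<close> plays the exact eigenvector for the problem on \<open>V1k\<close>, and
    approximation is measured by the coarse \<open>\<eta>1\<close>.\<close>
  have WVk: "V1k \<subseteq> Vs k"
    unfolding V1k_def using Vmono[OF k] vhat(1) subk by (intro span_minimal) auto
  have vhW: "vhat \<in> V1k" unfolding V1k_def by (rule span_base) simp
  have pair1: "galerkin_eigenpair a (Vs 1) lbar1 vbar1" and pairk: "galerkin_eigenpair a (Vs k) lbar vbar"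
    and pairW: "galerkin_eigenpair a V1k lam_l1 v_l1"
    using bar1(1) bark(1) new(1) by (auto simp: closest_pair_def)
  have l: "0 < lam1" and lam: "0 < lam" and lb: "0 < lbar" and lb1: "0 < lbar1" and ll: "0 < lam_l1"
    using lam1(1) exact pair1 pairk pairW by (auto dest: eigenpair_facts(2))
  have l_le: "lam1 \<le> lam" using lam1(2) exact by blast
  have poinc: "lam1 * (w \<bullet> w) \<le> a w w" for w by (rule poincare[OF l lam1(2)])
  have \<eta>0: "0 \<le> \<eta>1" unfolding \<eta>1_def by (rule eta_nonneg[OF l poinc V0])
  define M where "M = 2 * \<bar>lam\<bar> * (1 + 1 / (lam1 * \<delta>)) + lbar1 * sqrt (1 + 1 / (lam1 * \<delta>\<^sup>2) * \<eta>1\<^sup>2)"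
  define E where "E = enorm a (vbar - v_l1)"
  define E0 where "E0 = enorm a (vbar - v_l)"
  define s where "s = sqrt lam1"
  have E: "0 \<le> E" unfolding E_def by (rule enorm_nonneg)
  have s: "0 < s" using l by (simp add: s_def)
  have mesh: "4 * lam\<^sup>2 * (1 + 1 / (lam1 * \<delta>))\<^sup>2 * \<eta>1\<^sup>2 \<le> lam1"
    by (rule small_imp_mesh_bound[OF l lam \<delta> \<eta>0 lb1 small]) (use l in simp)
  note close = mesh_bound_imp_close[OF l l_le \<delta> mesh]
  note ce = closest_eigenvalue[OF l poinc exact _ _ V0, folded \<eta>1_def]
  note close1 = close[OF ce[OF sub1 subset_refl bar1(1)]]
    and closek = close[OF ce[OF subk Vmono[OF k] bark(1)]]
    and closeW = close[OF ce[OF subW V1W new(1)]]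
  \<comment> \<open>Moving the reference point from \<open>1 / lam\<close> to
    \<open>1 / lbar\<close> costs at most a tenth of \<open>\<delta>\<close>.\<close>
  have gap: "9/10 * \<delta> \<le> \<bar>1 / \<mu> - 1 / lbar\<bar>" if "galerkin_eigenpair a V1k \<mu> u" "a u v_l1 = 0" for \<mu> u
  proof -
    have "\<delta> \<le> \<bar>1 / \<mu> - 1 / lam\<bar>" using new(2) that by (auto simp: gap_bound_def)
    then show ?thesis using closek(2) by linarith
  qed
  let ?K = "lbar * (1 + 1 / (lam1 * (9/10 * \<delta>)))
    + sqrt (lbar * lam_l1) * sqrt ((1 + \<eta>1\<^sup>2 / (lam1 * (9/10 * \<delta>)\<^sup>2)) / 2)"
  have "norm (lbar *\<^sub>R vbar - lam_l1 *\<^sub>R v_l1) \<le> ?K * \<eta>1 * E"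
    unfolding E_def \<eta>1_def
    by (rule galerkin_eigen_error[OF l poinc pairk subk subW WVk V1W V0 pairW new(3) _ gap]) (use \<delta> in auto)
  also have "\<dots> \<le> M * \<eta>1 * E"
    unfolding M_def
    by (intro mult_right_mono constant_comparison l l_le \<delta> mesh lb ll lb1 closek(1) closeW(1) close1(1) \<eta>0 E)
  finally have second: "norm (lbar *\<^sub>R vbar - lam_l1 *\<^sub>R v_l1) \<le> M * \<eta>1 * E" .
  \<comment> \<open>The augmentation makes \<open>vhat\<close> an admissible competitor.\<close>
  have "E \<le> enorm a (vbar - vhat) + norm (lbar *\<^sub>R vbar - lam_l1 *\<^sub>R v_l1) / s"
    unfolding E_def s_def by (rule galerkin_quasi_optimal[OF l poinc pairk subW WVk pairW vhW])
  also have "\<dots> \<le> (\<theta> * E0 + (1 + \<theta>) * (norm (lbar *\<^sub>R vbar - lam_l *\<^sub>R v_l) / s)) + (M * \<eta>1 * E) / s"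
    unfolding E0_def s_def
    by (intro add_mono divide_right_mono second
        inexact_solve_error[OF l poinc pairk subk vtil vhat(2) \<theta>(1)]) (use l in auto)
  also have "\<dots> \<le> (\<theta> * E0 + (1 + \<theta>) * ((C1 * \<eta>1 * E0) / s)) + (M * \<eta>1 * E) / s"
    using hypl s \<theta> by (intro add_right_mono add_left_mono mult_left_mono divide_right_mono) (auto simp: E0_def)
  \<comment> \<open>Absorption: the term in \<open>E\<close> moves to the left, where
    \<open>small\<close> keeps its coefficient positive.\<close>
  finally have "(1 - 1 / s * M * \<eta>1) * E \<le> (\<theta> + (1 + \<theta>) * (C1 / s) * \<eta>1) * E0"
    by (simp add: algebra_simps)
  moreover have "0 < 1 - 1 / s * M * \<eta>1" using small by (simp add: M_def s_def)
  ultimately have "E \<le> (1 / (1 - 1 / s * M * \<eta>1)) * (\<theta> + (1 + \<theta>) * (C1 / s) * \<eta>1) * E0"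
    by (simp add: pos_le_divide_eq mult.commute)
  with second show ?thesis unfolding M_def E_def E0_def s_def by blast
qed

end
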